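(* Let $f_0\in\mathscr{D}(\mathfrak{X})$ be the true density, let $\mu$ be a prior on $\Phi$ for the hyper-parameter $\phi$, let $\Pi$ be a prior on $\mathscr{M}(\Theta)$ for the mixing distribution $P$, and let $\Pi^*$ be the prior induced on $\mathscr{D}(\mathfrak{X})$ by $\mu\times\Pi$ via the map $(\phi,P)\mapsto f_{P,\phi}$, where $f_{P,\phi}(x)=\int_\Theta K(x;\theta,\phi)\,dP(\theta)$. Suppose that for any $\epsilon>0$ there exist $P_\epsilon\in\mathscr{M}(\Theta)$, $\phi_\epsilon\in\Phi$, $A\subset\Phi$ with $\mu(A)>0$ and $\mathscr{W}\subset\mathscr{M}(\Theta)$ with $\Pi(\mathscr{W})>0$ such that (A1) $\int f_0\log\frac{f_0}{f_{P_\epsilon,\phi_\epsilon}}<\epsilon$; (A2) $\int f_0\log\frac{f_{P_\epsilon,\phi_\epsilon}}{f_{P_\epsilon,\phi}}<\epsilon$ for every $\phi\in A$; and (A3) $\int f_0\log\frac{f_{P_\epsilon,\phi}}{f_{P,\phi}}<\epsilon$ for every $P\in\mathscr{W}$, $\phi\in A$. Then $f_0\in\mathrm{KL}(\Pi^* )$.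
   Context: $\mathfrak{X}$ is the sample space, $\Theta$ the space of the mixing parameter $\theta$, $\Phi$ the space of the hyper-parameter $\phi$ (all possibly multidimensional). $\mathscr{D}(\mathfrak{X})$ is the set of probability densities on $\mathfrak{X}$ and $\mathscr{M}(\Theta)$ the set of probability measures on $\Theta$. The kernel $K(x;\theta,\phi)$ is a jointly measurable function such that for all $\theta,\phi$, $K(\cdot;\theta,\phi)$ is a probability density on $\mathfrak{X}$. A prior is a probability measure on the indicated space; $\phi\sim\mu$ and $P\sim\Pi$ are independent. For densities $f,g$, $\mathcal{K}(f;g)=\int f\log(f/g)$. One writes $f_0\in\mathrm{KL}(\Pi^* )$ (the Kullback-Leibler property holds at $f_0$) if $\Pi^*(\{g:\mathcal{K}(f_0;g)<\epsilon\})>0$ for every $\epsilon>0$. *)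

theory Defs
  imports "HOL-Probability.Probability"
begin

text \<open>
  Densities are taken with respect to a reference measure \<open>\<nu>\<close> on the sample space and are
  \<^typ>\<open>ennreal\<close>-valued, as for \<^const>\<open>density\<close> and \<^const>\<open>distributed\<close>. A mixture of kernels
  may be infinite on a null set, and with this choice it is still a density without modification.
\<close>

definition densities :: "'x measure \<Rightarrow> ('x \<Rightarrow> ennreal) set" where
  "densities \<nu> = {f \<in> borel_measurable \<nu>. (\<integral>\<^sup>+ x. f x \<partial>\<nu>) = 1}"

text \<open>
  The spaces \<open>\<Theta>\<close> and \<open>\<Phi>\<close> are measurable spaces; any measure they carry is ignored.
\<close>

definition kernel_density ::
    "'x measure \<Rightarrow> 't measure \<Rightarrow> 'p measure \<Rightarrow> ('x \<Rightarrow> 't \<Rightarrow> 'p \<Rightarrow> ennreal) \<Rightarrow> bool" where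
  "kernel_density \<nu> \<Theta> \<Phi> K \<longleftrightarrow>
     (\<lambda>(x, \<theta>, \<phi>). K x \<theta> \<phi>) \<in> borel_measurable (\<nu> \<Otimes>\<^sub>M \<Theta> \<Otimes>\<^sub>M \<Phi>) \<and>
     (\<forall>\<theta>\<in>space \<Theta>. \<forall>\<phi>\<in>space \<Phi>. (\<lambda>x. K x \<theta> \<phi>) \<in> densities \<nu>)"

definition mixture ::
    "('x \<Rightarrow> 't \<Rightarrow> 'p \<Rightarrow> ennreal) \<Rightarrow> 't measure \<Rightarrow> 'p \<Rightarrow> 'x \<Rightarrow> ennreal" where
  "mixture K P \<phi> x = (\<integral>\<^sup>+ \<theta>. K x \<theta> \<phi> \<partial>P)"

text \<open>
  The natural logarithm on $[0,\infty]$, with $\log 0 = -\infty$ and $\log \infty = \infty$.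
\<close>

definition ext_ln :: "ennreal \<Rightarrow> ereal" where
  "ext_ln r = (if r = 0 then - \<infinity> else if r = \<infinity> then \<infinity> else ereal (ln (enn2real r)))"

text \<open>
  The integral of an extended real-valued function, as the integral of the positive part minus
  that of the negative part; \<^const>\<open>e2ennreal\<close> sends negative arguments to 0. The Bochner
  integral (and hence \<^const>\<open>KL_divergence\<close>) is unsuitable, because it is 0 for functions that
  are not integrable, so that an infinite divergence would count as small. Here an integral may be
  infinite, and the undefined case takes the value \<open>\<infinity> - \<infinity> = \<infinity>\<close>, which is never below \<open>\<epsilon>\<close>.
\<close>

definition ext_integral :: "'x measure \<Rightarrow> ('x \<Rightarrow> ereal) \<Rightarrow> ereal" where
  "ext_integral \<nu> h =
     enn2ereal (\<integral>\<^sup>+ x. e2ennreal (h x) \<partial>\<nu>) - enn2ereal (\<integral>\<^sup>+ x. e2ennreal (- h x) \<partial>\<nu>)"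

lemma ext_integral_eq_integral:
  assumes "integrable \<nu> h"
  shows "ext_integral \<nu> (\<lambda>x. ereal (h x)) = ereal (\<integral>x. h x \<partial>\<nu>)"
proof -
  have "(\<integral>\<^sup>+x. ennreal (h x) \<partial>\<nu>) < \<infinity>" "(\<integral>\<^sup>+x. ennreal (- h x) \<partial>\<nu>) < \<infinity>"
    using assms by (auto simp: real_integrable_def top.not_eq_extremum)
  then obtain a b where "(\<integral>\<^sup>+x. ennreal (h x) \<partial>\<nu>) = ennreal a" "0 \<le> a"
      "(\<integral>\<^sup>+x. ennreal (- h x) \<partial>\<nu>) = ennreal b" "0 \<le> b"
    by (metis ennreal_cases less_irrefl infinity_ennreal_def)
  then show ?thesis
    using real_lebesgue_integral_def[OF assms] by (simp add: ext_integral_def enn2ereal_ennreal)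
qed

text \<open>
  The integral $\int f \log (g/h)$. Where \<open>f = 0\<close> the integrand is 0, since \<open>0 * \<infinity> = 0\<close> in
  \<^typ>\<open>ereal\<close>; where \<open>g > 0\<close> and \<open>h = 0\<close> the logarithm is \<open>\<infinity>\<close>.
\<close>

definition log_ratio_integral ::
    "'x measure \<Rightarrow> ('x \<Rightarrow> ennreal) \<Rightarrow> ('x \<Rightarrow> ennreal) \<Rightarrow> ('x \<Rightarrow> ennreal) \<Rightarrow> ereal" where
  "log_ratio_integral \<nu> f g h = ext_integral \<nu> (\<lambda>x. enn2ereal (f x) * ext_ln (g x / h x))"

definition KL_div :: "'x measure \<Rightarrow> ('x \<Rightarrow> ennreal) \<Rightarrow> ('x \<Rightarrow> ennreal) \<Rightarrow> ereal" where
  "KL_div \<nu> f g = log_ratio_integral \<nu> f f g"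

text \<open>
  The prior on densities is the image of \<open>\<mu> \<times> \<pi>\<close> under \<open>(\<phi>, P) \<mapsto> f\<^sub>P\<^sub>,\<^sub>\<phi>\<close>. The set of
  densities carries the largest \<open>\<sigma>\<close>-algebra for which this map is measurable, so the induced prior
  of a set is the \<open>\<mu> \<times> \<pi>\<close>-measure of its preimage whenever that preimage is measurable. On any
  smaller \<open>\<sigma>\<close>-algebra the image measure is the restriction of this one.
\<close>

definition induced_prior ::
    "'x measure \<Rightarrow> ('x \<Rightarrow> 't \<Rightarrow> 'p \<Rightarrow> ennreal) \<Rightarrow> 'p measure \<Rightarrow> 't measure measure \<Rightarrow>
     ('x \<Rightarrow> ennreal) measure" where
  "induced_prior \<nu> K \<mu> \<pi> =
     (let T = (\<lambda>(\<phi>, P). mixture K P \<phi>)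
      in distr (\<mu> \<Otimes>\<^sub>M \<pi>)
           (sigma (densities \<nu>)
              {B. B \<subseteq> densities \<nu> \<and> T -` B \<inter> space (\<mu> \<Otimes>\<^sub>M \<pi>) \<in> sets (\<mu> \<Otimes>\<^sub>M \<pi>)})
           T)"

lemma mixture_in_densities:
  assumes "sigma_finite_measure \<nu>" "kernel_density \<nu> \<Theta> \<Phi> K"
    and P: "P \<in> space (prob_algebra \<Theta>)" and "\<phi> \<in> space \<Phi>"
  shows "mixture K P \<phi> \<in> densities \<nu>"
proof -
  interpret \<nu>: sigma_finite_measure \<nu> by fact
  interpret prob: prob_space P using P by (simp add: space_prob_algebra)
  interpret pair_sigma_finite \<nu> P by standard
  have sP[measurable_cong]: "sets P = sets \<Theta>" using P by (simp add: space_prob_algebra)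
  have spP: "space P = space \<Theta>" using sP by (rule sets_eq_imp_space_eq)
  have K[measurable]: "(\<lambda>(x, \<theta>, \<phi>). K x \<theta> \<phi>) \<in> borel_measurable (\<nu> \<Otimes>\<^sub>M \<Theta> \<Otimes>\<^sub>M \<Phi>)"
    and d: "\<And>\<theta>. \<theta> \<in> space \<Theta> \<Longrightarrow> (\<integral>\<^sup>+ x. K x \<theta> \<phi> \<partial>\<nu>) = 1"
    using assms by (auto simp: kernel_density_def densities_def)
  have "(\<lambda>(x, \<theta>). (x, \<theta>, \<phi>)) \<in> \<nu> \<Otimes>\<^sub>M P \<rightarrow>\<^sub>M \<nu> \<Otimes>\<^sub>M \<Theta> \<Otimes>\<^sub>M \<Phi>"
    using \<open>\<phi> \<in> space \<Phi>\<close> by measurable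
  from measurable_compose[OF this K]
  have m: "(\<lambda>(x, \<theta>). K x \<theta> \<phi>) \<in> borel_measurable (\<nu> \<Otimes>\<^sub>M P)"
    by (simp add: case_prod_beta')
  have "(\<integral>\<^sup>+ x. \<integral>\<^sup>+ \<theta>. K x \<theta> \<phi> \<partial>P \<partial>\<nu>) = (\<integral>\<^sup>+ \<theta>. \<integral>\<^sup>+ x. K x \<theta> \<phi> \<partial>\<nu> \<partial>P)"
    using Fubini'[OF m] by simp
  also have "\<dots> = (\<integral>\<^sup>+ \<theta>. 1 \<partial>P)"
    by (intro nn_integral_cong) (simp add: d spP)
  also have "\<dots> = 1" by (simp add: prob.emeasure_space_1)
  finally have "(\<integral>\<^sup>+ x. \<integral>\<^sup>+ \<theta>. K x \<theta> \<phi> \<partial>P \<partial>\<nu>) = 1" .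
  moreover have "(\<lambda>x. \<integral>\<^sup>+ \<theta>. K x \<theta> \<phi> \<partial>P) \<in> borel_measurable \<nu>"
    using m by (rule prob.borel_measurable_nn_integral)
  ultimately show ?thesis
    by (simp add: densities_def mixture_def[abs_def])
qed

lemma emeasure_induced_prior:
  assumes "sigma_finite_measure \<nu>" "kernel_density \<nu> \<Theta> \<Phi> K"
    and \<mu>: "\<mu> \<in> space (prob_algebra \<Phi>)" and \<pi>: "\<pi> \<in> space (prob_algebra (prob_algebra \<Theta>))"
    and B: "B \<subseteq> densities \<nu>"
      "{(\<phi>, P) \<in> space (\<mu> \<Otimes>\<^sub>M \<pi>). mixture K P \<phi> \<in> B} \<in> sets (\<mu> \<Otimes>\<^sub>M \<pi>)"
  shows "emeasure (induced_prior \<nu> K \<mu> \<pi>) B =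
    emeasure (\<mu> \<Otimes>\<^sub>M \<pi>) {(\<phi>, P) \<in> space (\<mu> \<Otimes>\<^sub>M \<pi>). mixture K P \<phi> \<in> B}"
proof -
  define T where "T = (\<lambda>(\<phi>, P). mixture K P \<phi>)"
  define S where
    "S = {B. B \<subseteq> densities \<nu> \<and> T -` B \<inter> space (\<mu> \<Otimes>\<^sub>M \<pi>) \<in> sets (\<mu> \<Otimes>\<^sub>M \<pi>)}"
  have sp: "space \<mu> = space \<Phi>" "space \<pi> = space (prob_algebra \<Theta>)"
    using \<mu> \<pi> by (auto simp: space_prob_algebra dest: sets_eq_imp_space_eq)
  have eq: "T -` B \<inter> space (\<mu> \<Otimes>\<^sub>M \<pi>) = {(\<phi>, P) \<in> space (\<mu> \<Otimes>\<^sub>M \<pi>). mixture K P \<phi> \<in> B}"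
    by (auto simp: T_def)
  have "T \<in> \<mu> \<Otimes>\<^sub>M \<pi> \<rightarrow>\<^sub>M sigma (densities \<nu>) S"
    using mixture_in_densities[OF assms(1,2)]
    by (intro measurable_measure_of) (auto simp: T_def S_def space_pair_measure sp)
  moreover have "B \<in> sets (sigma (densities \<nu>) S)"
    by (rule in_measure_of) (use B in \<open>auto simp: S_def eq\<close>)
  ultimately show ?thesis
    unfolding induced_prior_def Let_def T_def[symmetric] S_def[symmetric]
    by (subst emeasure_distr) (simp_all only: eq)
qed

definition KL_property :: "'x measure \<Rightarrow> ('x \<Rightarrow> ennreal) measure \<Rightarrow> ('x \<Rightarrow> ennreal) set" where
  "KL_property \<nu> \<rho> =
     {f \<in> densities \<nu>. \<forall>\<epsilon>::real. \<epsilon> > 0 \<longrightarrow> emeasure \<rho> {g \<in> densities \<nu>. KL_div \<nu> f g < ereal \<epsilon>} > 0}"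

end

theory Submission
  imports Defs
begin

text \<open>
  Pointwise \<open>log (f\<^sub>0 / f\<^sub>P\<^sub>,\<^sub>\<phi>)\<close> is the sum of the three log ratios in the hypotheses, so for
  \<open>(\<phi>, P) \<in> A \<times> W\<close> the divergence from \<open>f\<^sub>0\<close> to \<open>f\<^sub>P\<^sub>,\<^sub>\<phi>\<close> is less than three times the common bound.
  The rectangle \<open>A \<times> W\<close> has positive measure under the product prior, by independence, and it lies
  in the preimage of the Kullback-Leibler neighbourhood.

  Two points need care. First, the integrals are extended real numbers, and cancelling an
  intermediate mixture in a product of ratios is legitimate only where it is neither \<open>0\<close> nor \<open>\<infinity>\<close>.
  An integral that is less than a real number has an integrable positive part; hence its integrand
  is less than \<open>\<infinity>\<close> almost everywhere, which excludes zeros of the successive denominators where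
  \<open>f\<^sub>0 > 0\<close>, while infinite values are excluded because densities integrate to 1. A negative part
  with infinite integral only makes the sum \<open>- \<infinity>\<close> (\<open>ext_integral_add_less\<close>). This gives
  \<open>KL_div_triangle_less\<close>. Secondly, the preimage of the neighbourhood must be measurable for its
  prior probability to be meaningful; this follows from the joint measurability of the kernel
  and of integration in the pair of integrand and measure (\<open>measurable_KL_div_mixture\<close>).
\<close>

section \<open>Extended integrals and logarithms\<close>

lemma borel_measurable_ext_ln [measurable]: "ext_ln \<in> borel_measurable borel"
  unfolding ext_ln_def by measurable

lemma ext_ln_divide:
  assumes "g \<noteq> 0" "g \<noteq> \<infinity>" "h \<noteq> 0" "h \<noteq> \<infinity>"
  shows "ext_ln (g / h) = ereal (ln (enn2real g) - ln (enn2real h))"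
proof -
  obtain a where a: "g = ennreal a" "a > 0"
    using assms by (cases g) (auto simp: less_le)
  obtain b where b: "h = ennreal b" "b > 0"
    using assms by (cases h) (auto simp: less_le)
  show ?thesis
    using a b by (simp add: ext_ln_def divide_ennreal ln_div)
qed

lemma ext_ln_top: "ext_ln \<top> = \<infinity>"
  by (simp add: ext_ln_def)

lemma nn_integral_finite_if_ext_integral_less:
  assumes "ext_integral \<nu> u < ereal a"
  shows "(\<integral>\<^sup>+ x. e2ennreal (u x) \<partial>\<nu>) \<noteq> \<infinity>"
  using assms by (auto simp: ext_integral_def)

lemma AE_less_infinity_if_ext_integral_less:
  assumes [measurable]: "u \<in> borel_measurable \<nu>" and "ext_integral \<nu> u < ereal a"
  shows "AE x in \<nu>. u x < \<infinity>"
proof -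
  have "AE x in \<nu>. e2ennreal (u x) \<noteq> \<infinity>"
    using nn_integral_finite_if_ext_integral_less[OF assms(2)]
    by (intro nn_integral_PInf_AE) auto
  then show ?thesis
    by eventually_elim (auto simp: less_top[symmetric])
qed

text \<open>
  Both sides rearrange \<open>u + v = (u\<^sup>+ - u\<^sup>-) + (v\<^sup>+ - v\<^sup>-)\<close> so that no subtraction occurs; this form
  remains meaningful when negative parts, or later their integrals, are infinite.
\<close>

lemma e2ennreal_parts_add:
  assumes "u < \<infinity>" "v < \<infinity>"
  shows "e2ennreal u + e2ennreal v + e2ennreal (- (u + v)) =
    e2ennreal (u + v) + (e2ennreal (- u) + e2ennreal (- v))"
proof (cases "u = - \<infinity> \<or> v = - \<infinity>")
  case True
  then show ?thesis
    using assms by (cases u; cases v) auto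
next
  case False
  then obtain a b where ab: "u = ereal a" "v = ereal b"
    using assms by (cases u; cases v) auto
  have r: "e2ennreal (ereal r) = ennreal (max 0 r)" for r
    by (simp add: max_def ennreal_neg)
  have "max 0 a + max 0 b + max 0 (- (a + b)) = max 0 (a + b) + (max 0 (- a) + max 0 (- b))"
    by linarith
  then show ?thesis
    by (simp add: ab r ennreal_plus[symmetric]
      del: ennreal_plus e2ennreal_ereal ennreal_max_0 ennreal_max_0')
qed

lemma ext_integral_add_less:
  assumes [measurable]: "u \<in> borel_measurable \<nu>" "v \<in> borel_measurable \<nu>"
    and u: "ext_integral \<nu> u < ereal a" and v: "ext_integral \<nu> v < ereal b"
  shows "ext_integral \<nu> (\<lambda>x. u x + v x) < ereal (a + b)"
proof -
  define I where "I w = (\<integral>\<^sup>+ x. e2ennreal (w x) \<partial>\<nu>)" for w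
  define w where "w x = u x + v x" for x
  have [measurable]: "w \<in> borel_measurable \<nu>"
    unfolding w_def by measurable
  have AE: "AE x in \<nu>. u x < \<infinity>" "AE x in \<nu>. v x < \<infinity>"
    by (rule AE_less_infinity_if_ext_integral_less[OF _ u], measurable)
      (rule AE_less_infinity_if_ext_integral_less[OF _ v], measurable)
  have "(\<integral>\<^sup>+ x. e2ennreal (u x) + e2ennreal (v x) + e2ennreal (- w x) \<partial>\<nu>) =
      (\<integral>\<^sup>+ x. e2ennreal (w x) + (e2ennreal (- u x) + e2ennreal (- v x)) \<partial>\<nu>)"
    using AE by (intro nn_integral_cong_AE, eventually_elim)
      (simp only: w_def e2ennreal_parts_add)
  then have eq: "I u + I v + I (\<lambda>x. - w x) = I w + (I (\<lambda>x. - u x) + I (\<lambda>x. - v x))"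
    by (simp add: I_def nn_integral_add)
  have fin: "I u \<noteq> \<infinity>" "I v \<noteq> \<infinity>"
    using nn_integral_finite_if_ext_integral_less[OF u]
      nn_integral_finite_if_ext_integral_less[OF v] by (simp_all add: I_def)
  have "I w \<le> (\<integral>\<^sup>+ x. e2ennreal (u x) + e2ennreal (v x) \<partial>\<nu>)"
    unfolding I_def
  proof (rule nn_integral_mono)
    fix x
    have pos: "y \<le> enn2ereal (e2ennreal y)" for y
      by (cases "0 \<le> y") (auto simp: enn2ereal_e2ennreal e2ennreal_neg zero_ennreal.rep_eq)
    have "u x + v x \<le> enn2ereal (e2ennreal (u x) + e2ennreal (v x))"
      unfolding plus_ennreal.rep_eq by (intro add_mono pos)
    then have "e2ennreal (u x + v x) \<le> e2ennreal (enn2ereal (e2ennreal (u x) + e2ennreal (v x)))"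
      by (rule e2ennreal_mono)
    then show "e2ennreal (w x) \<le> e2ennreal (u x) + e2ennreal (v x)"
      by (simp add: w_def)
  qed
  then have "I w \<le> I u + I v"
    by (simp add: I_def nn_integral_add)
  with fin have finw: "I w \<noteq> \<infinity>"
    by (auto simp: top_unique)
  have ul: "enn2ereal (I u) - enn2ereal (I (\<lambda>x. - u x)) < ereal a"
    and vl: "enn2ereal (I v) - enn2ereal (I (\<lambda>x. - v x)) < ereal b"
    using u v by (simp_all add: ext_integral_def I_def)
  have "enn2ereal (I w) - enn2ereal (I (\<lambda>x. - w x)) < ereal (a + b)"
  proof (cases "I (\<lambda>x. - w x) = \<infinity>")
    case True
    then show ?thesis
      using finw by (cases "I w") auto
  next
    case False
    \<comment> \<open>then all six integrals are finite, and the claim is linear arithmetic\<close>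
    with eq fin have fin': "I (\<lambda>x. - u x) \<noteq> \<infinity>" "I (\<lambda>x. - v x) \<noteq> \<infinity>"
      by (auto simp: ennreal_add_eq_top)
    have real: "\<exists>r\<ge>0. y = ennreal r" if "y \<noteq> \<infinity>" for y
      using that by (cases y) auto
    obtain p q r where pqr: "I u = ennreal p" "p \<ge> 0" "I v = ennreal q" "q \<ge> 0"
        "I w = ennreal r" "r \<ge> 0"
      using real[OF fin(1)] real[OF fin(2)] real[OF finw] by blast
    obtain p' q' r' where pqr': "I (\<lambda>x. - u x) = ennreal p'" "p' \<ge> 0"
        "I (\<lambda>x. - v x) = ennreal q'" "q' \<ge> 0" "I (\<lambda>x. - w x) = ennreal r'" "r' \<ge> 0"
      using real[OF fin'(1)] real[OF fin'(2)] real[OF False] by blast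
    have "p + q + r' = r + (p' + q')"
      using eq pqr(2,4,6) pqr'(2,4,6) unfolding pqr pqr'
      by (simp add: ennreal_plus[symmetric] del: ennreal_plus)
    moreover have "p - p' < a" "q - q' < b"
      using ul vl pqr(2,4) pqr'(2,4) unfolding pqr pqr' by (simp_all add: enn2ereal_ennreal)
    ultimately show ?thesis
      using pqr(6) pqr'(6) unfolding pqr pqr' by (simp add: enn2ereal_ennreal)
  qed
  then show ?thesis
    by (simp add: ext_integral_def I_def w_def)
qed

section \<open>A triangle inequality for log ratios\<close>

lemma AE_densities_finite:
  assumes "f \<in> densities \<nu>"
  shows "AE x in \<nu>. f x \<noteq> \<infinity>"
  using assms by (intro nn_integral_PInf_AE) (auto simp: densities_def)

text \<open>
  Taking \<open>f\<close> as the first numerator makes the hypotheses propagate positivity: on \<open>{f > 0}\<close>,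
  finiteness of \<open>log (f / g)\<close> gives \<open>g > 0\<close>, and then finiteness of \<open>log (g / h)\<close> gives \<open>h > 0\<close>.
\<close>

lemma KL_div_triangle_less:
  assumes f: "f \<in> densities \<nu>" and g: "g \<in> densities \<nu>" and h: "h \<in> densities \<nu>"
    and fg: "KL_div \<nu> f g < ereal a" and gh: "log_ratio_integral \<nu> f g h < ereal b"
  shows "KL_div \<nu> f h < ereal (a + b)"
proof -
  have [measurable]: "f \<in> borel_measurable \<nu>" "g \<in> borel_measurable \<nu>" "h \<in> borel_measurable \<nu>"
    using f g h by (auto simp: densities_def)
  define u where "u x = enn2ereal (f x) * ext_ln (f x / g x)" for x
  define v where "v x = enn2ereal (f x) * ext_ln (g x / h x)" for x
  have [measurable]: "u \<in> borel_measurable \<nu>" "v \<in> borel_measurable \<nu>"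
    unfolding u_def v_def by measurable
  have u: "ext_integral \<nu> u < ereal a" and v: "ext_integral \<nu> v < ereal b"
    using fg gh by (simp_all add: KL_div_def log_ratio_integral_def u_def[abs_def] v_def[abs_def])
  have "AE x in \<nu>. u x < \<infinity>"
    by (rule AE_less_infinity_if_ext_integral_less[OF _ u]) measurable
  moreover have "AE x in \<nu>. v x < \<infinity>"
    by (rule AE_less_infinity_if_ext_integral_less[OF _ v]) measurable
  ultimately have "AE x in \<nu>. enn2ereal (f x) * ext_ln (f x / h x) = u x + v x"
    using AE_densities_finite[OF f] AE_densities_finite[OF g] AE_densities_finite[OF h]
  proof (eventually_elim)
    case (elim x)
    show ?case
    proof (cases "f x = 0")
      case True
      then show ?thesis
        by (simp add: u_def v_def zero_ennreal.rep_eq)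
    next
      case False
      then obtain r where r: "f x = ennreal r" "r > 0"
        using elim by (cases "f x") (auto simp: less_le)
      have "g x \<noteq> 0"
        using elim(1) False r by (auto simp: u_def ext_ln_top enn2ereal_ennreal)
      moreover from this have "h x \<noteq> 0"
        using elim(2) r by (auto simp: v_def ext_ln_top enn2ereal_ennreal)
      ultimately show ?thesis
        using False elim r
        by (simp add: u_def v_def ext_ln_divide enn2ereal_ennreal algebra_simps)
    qed
  qed
  then have "KL_div \<nu> f h = ext_integral \<nu> (\<lambda>x. u x + v x)"
    unfolding KL_div_def log_ratio_integral_def ext_integral_def
    by (intro arg_cong2[where f = "(-)"] arg_cong[where f = enn2ereal] nn_integral_cong_AE) auto
  then show ?thesis
    using ext_integral_add_less[OF _ _ u v] by simp
qed

section \<open>Measurability of the divergence to a mixture\<close>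

text \<open>
  Measurability in \<open>P\<close> holds because the \<open>\<sigma>\<close>-algebra on probability measures makes integration
  of jointly measurable functions measurable; the variable \<open>x\<close> is
  treated jointly with \<open>(\<phi>, P)\<close>, so that expressions in the mixture can then be integrated over
  \<open>x\<close> and remain measurable in \<open>(\<phi>, P)\<close>.
\<close>

lemma measurable_mixture:
  assumes "kernel_density \<nu> \<Theta> \<Phi> K"
  shows "(\<lambda>((\<phi>, P), x). mixture K P \<phi> x) \<in>
    borel_measurable ((\<Phi> \<Otimes>\<^sub>M prob_algebra \<Theta>) \<Otimes>\<^sub>M \<nu>)"
proof -
  have K: "(\<lambda>(x, \<theta>, \<phi>). K x \<theta> \<phi>) \<in> borel_measurable (\<nu> \<Otimes>\<^sub>M \<Theta> \<Otimes>\<^sub>M \<Phi>)"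
    using assms by (simp add: kernel_density_def)
  let ?M = "(\<Phi> \<Otimes>\<^sub>M prob_algebra \<Theta>) \<Otimes>\<^sub>M \<nu>"
  have "(\<lambda>(z, \<theta>). (snd z, \<theta>, fst (fst z))) \<in> ?M \<Otimes>\<^sub>M \<Theta> \<rightarrow>\<^sub>M \<nu> \<Otimes>\<^sub>M \<Theta> \<Otimes>\<^sub>M \<Phi>"
    by measurable
  from measurable_compose[OF this K]
  have "(\<lambda>(z, \<theta>). K (snd z) \<theta> (fst (fst z))) \<in> borel_measurable (?M \<Otimes>\<^sub>M \<Theta>)"
    by (simp add: case_prod_beta')
  moreover have "(\<lambda>z. snd (fst z)) \<in> ?M \<rightarrow>\<^sub>M subprob_algebra \<Theta>"
    by (intro measurable_prob_algebraD) measurable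
  ultimately have "(\<lambda>z. \<integral>\<^sup>+ \<theta>. K (snd z) \<theta> (fst (fst z)) \<partial>snd (fst z)) \<in> borel_measurable ?M"
    by (rule nn_integral_measurable_subprob_algebra2)
  then show ?thesis
    by (simp add: mixture_def case_prod_beta')
qed

lemma measurable_KL_div_mixture:
  assumes "sigma_finite_measure \<nu>" "kernel_density \<nu> \<Theta> \<Phi> K"
    and [measurable]: "f \<in> borel_measurable \<nu>"
  shows "(\<lambda>(\<phi>, P). KL_div \<nu> f (mixture K P \<phi>)) \<in> borel_measurable (\<Phi> \<Otimes>\<^sub>M prob_algebra \<Theta>)"
proof -
  interpret sigma_finite_measure \<nu> by fact
  have [measurable]: "(\<lambda>z. mixture K (snd (fst z)) (fst (fst z)) (snd z)) \<in>
      borel_measurable ((\<Phi> \<Otimes>\<^sub>M prob_algebra \<Theta>) \<Otimes>\<^sub>M \<nu>)"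
    using measurable_mixture[OF assms(2)] by (simp add: case_prod_beta')
  show ?thesis
    unfolding KL_div_def log_ratio_integral_def ext_integral_def case_prod_beta'
    by measurable
qed

section \<open>The Kullback-Leibler property\<close>

theorem theorem1:
  fixes \<nu> :: "'x measure" and \<Theta> :: "'t measure" and \<Phi> :: "'p measure"
    and K :: "'x \<Rightarrow> 't \<Rightarrow> 'p \<Rightarrow> ennreal"
    and f0 :: "'x \<Rightarrow> ennreal" and \<mu> :: "'p measure" and \<pi> :: "'t measure measure"
  assumes "sigma_finite_measure \<nu>"
    and "kernel_density \<nu> \<Theta> \<Phi> K"
    and "f0 \<in> densities \<nu>"
    and "\<mu> \<in> space (prob_algebra \<Phi>)"
    and "\<pi> \<in> space (prob_algebra (prob_algebra \<Theta>))"
    and "\<And>\<epsilon>::real. \<epsilon> > 0 \<Longrightarrow>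
      \<exists>P\<epsilon> \<in> space (prob_algebra \<Theta>). \<exists>\<phi>\<epsilon> \<in> space \<Phi>. \<exists>A \<in> sets \<mu>. \<exists>W \<in> sets \<pi>.
        emeasure \<mu> A > 0 \<and> emeasure \<pi> W > 0 \<and>
        log_ratio_integral \<nu> f0 f0 (mixture K P\<epsilon> \<phi>\<epsilon>) < ereal \<epsilon> \<and>
        (\<forall>\<phi>\<in>A. log_ratio_integral \<nu> f0 (mixture K P\<epsilon> \<phi>\<epsilon>) (mixture K P\<epsilon> \<phi>) < ereal \<epsilon>) \<and>
        (\<forall>P\<in>W. \<forall>\<phi>\<in>A. log_ratio_integral \<nu> f0 (mixture K P\<epsilon> \<phi>) (mixture K P \<phi>) < ereal \<epsilon>)"
  shows "f0 \<in> KL_property \<nu> (induced_prior \<nu> K \<mu> \<pi>)"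
proof -
  interpret \<pi>: prob_space \<pi>
    using assms(5) by (simp add: space_prob_algebra)
  have sets: "sets \<mu> = sets \<Phi>" "sets \<pi> = sets (prob_algebra \<Theta>)"
    using assms(4,5) by (auto simp: space_prob_algebra)
  then have space: "space \<mu> = space \<Phi>" "space \<pi> = space (prob_algebra \<Theta>)"
    by (auto dest: sets_eq_imp_space_eq)
  note dens = mixture_in_densities[OF assms(1,2)]
  have "emeasure (induced_prior \<nu> K \<mu> \<pi>) {g \<in> densities \<nu>. KL_div \<nu> f0 g < ereal \<epsilon>} > 0"
    if "\<epsilon> > 0" for \<epsilon> :: real
  proof -
    let ?B = "{g \<in> densities \<nu>. KL_div \<nu> f0 g < ereal \<epsilon>}"
    let ?N = "{(\<phi>, P) \<in> space (\<mu> \<Otimes>\<^sub>M \<pi>). mixture K P \<phi> \<in> ?B}"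
    obtain P' \<phi>' A W where PA: "P' \<in> space (prob_algebra \<Theta>)" "\<phi>' \<in> space \<Phi>"
        "A \<in> sets \<mu>" "W \<in> sets \<pi>"
      and pos: "emeasure \<mu> A > 0" "emeasure \<pi> W > 0"
      and A1: "log_ratio_integral \<nu> f0 f0 (mixture K P' \<phi>') < ereal (\<epsilon> / 3)"
      and A2: "\<And>\<phi>. \<phi> \<in> A \<Longrightarrow>
        log_ratio_integral \<nu> f0 (mixture K P' \<phi>') (mixture K P' \<phi>) < ereal (\<epsilon> / 3)"
      and A3: "\<And>P \<phi>. P \<in> W \<Longrightarrow> \<phi> \<in> A \<Longrightarrow>
        log_ratio_integral \<nu> f0 (mixture K P' \<phi>) (mixture K P \<phi>) < ereal (\<epsilon> / 3)"
      using assms(6)[of "\<epsilon> / 3"] \<open>\<epsilon> > 0\<close> by auto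
    have KL: "KL_div \<nu> f0 (mixture K P \<phi>) < ereal \<epsilon>" if "\<phi> \<in> A" "P \<in> W" for \<phi> P
    proof -
      have in_space: "\<phi> \<in> space \<Phi>" "P \<in> space (prob_algebra \<Theta>)"
        using that PA sets.sets_into_space space by blast+
      have "KL_div \<nu> f0 (mixture K P' \<phi>) < ereal (\<epsilon> / 3 + \<epsilon> / 3)"
        by (rule KL_div_triangle_less[OF assms(3) dens dens _ A2])
          (use PA in_space that A1 in \<open>simp_all add: KL_div_def\<close>)
      from KL_div_triangle_less[OF assms(3) dens dens this A3] PA in_space that
      have "KL_div \<nu> f0 (mixture K P \<phi>) < ereal (\<epsilon> / 3 + \<epsilon> / 3 + \<epsilon> / 3)"
        by blast
      then show ?thesis by simp
    qed
    have "(\<lambda>(\<phi>, P). KL_div \<nu> f0 (mixture K P \<phi>)) \<in> borel_measurable (\<mu> \<Otimes>\<^sub>M \<pi>)"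
      using measurable_KL_div_mixture[OF assms(1,2), of f0] assms(3)
      by (simp add: densities_def sets cong: measurable_cong_sets sets_pair_measure_cong)
    then have "{z \<in> space (\<mu> \<Otimes>\<^sub>M \<pi>). (case z of (\<phi>, P) \<Rightarrow> KL_div \<nu> f0 (mixture K P \<phi>)) < ereal \<epsilon>}
        \<in> sets (\<mu> \<Otimes>\<^sub>M \<pi>)"
      by measurable
    also have "{z \<in> space (\<mu> \<Otimes>\<^sub>M \<pi>). (case z of (\<phi>, P) \<Rightarrow> KL_div \<nu> f0 (mixture K P \<phi>)) < ereal \<epsilon>}
        = ?N"
      using dens by (auto simp: space_pair_measure space)
    finally have N: "?N \<in> sets (\<mu> \<Otimes>\<^sub>M \<pi>)" .
    have "0 < emeasure \<mu> A * emeasure \<pi> W"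
      using pos by (simp add: ennreal_zero_less_mult_iff)
    also have "\<dots> = emeasure (\<mu> \<Otimes>\<^sub>M \<pi>) (A \<times> W)"
      using PA by (simp add: \<pi>.emeasure_pair_measure_Times)
    also have "\<dots> \<le> emeasure (\<mu> \<Otimes>\<^sub>M \<pi>) ?N"
    proof (rule emeasure_mono[OF _ N])
      have "A \<subseteq> space \<mu>" "W \<subseteq> space \<pi>"
        using PA by (auto dest: sets.sets_into_space)
      then show "A \<times> W \<subseteq> ?N"
        using KL dens by (auto simp: space_pair_measure space subset_iff)
    qed
    also have "\<dots> = emeasure (induced_prior \<nu> K \<mu> \<pi>) ?B"
      using N by (intro emeasure_induced_prior[symmetric, OF assms(1,2,4,5)]) auto
    finally show ?thesis .
  qed
  then show ?thesis
    using assms(3) by (simp add: KL_property_def)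
qed

end
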